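(* Let $X$ be a topological space and $A\subset X$ a subspace. If $A$ is a retract of $X$, then $\mathrm{cat}(A)\le\mathrm{cat}(X)$.
   Context: $A\subset X$ is a retract of $X$ if there is a continuous map $r:X\to A$ with $r(a)=a$ for all $a\in A$. A continuous map is null-homotopic if it is (freely) homotopic to a constant map. The LS category $\mathrm{cat}(X)$ of a space $X$ is the least positive integer $k$ such that $X$ is a union of open subsets $U_1,\dots,U_k$ with each inclusion $U_j\hookrightarrow X$ null-homotopic, and $\infty$ if no such integer exists. *)

theory Defs
  imports "HOL-Analysis.Analysis" "HOL-Library.Extended_Nat"
begin

text \<open>The constant \<open>c\<close> automatically lies in \<open>topspace Y\<close> unless \<open>topspace X = {}\<close>;
  the empty map counts as null-homotopic, as in \<^const>\<open>contractible_space\<close>.\<close>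

definition null_homotopic :: "'a topology \<Rightarrow> 'b topology \<Rightarrow> ('a \<Rightarrow> 'b) \<Rightarrow> bool" where
  "null_homotopic X Y f \<longleftrightarrow>
     continuous_map X Y f \<and> (\<exists>c. homotopic_with (\<lambda>_. True) X Y f (\<lambda>_. c))"

definition categorical_cover :: "'a topology \<Rightarrow> nat \<Rightarrow> (nat \<Rightarrow> 'a set) \<Rightarrow> bool" where
  "categorical_cover X k U \<longleftrightarrow>
     (\<forall>j\<in>{1..k}. openin X (U j) \<and> null_homotopic (subtopology X (U j)) X (\<lambda>x. x)) \<and>
     (\<Union>j\<in>{1..k}. U j) = topspace X"

text \<open>On \<^typ>\<open>enat\<close>, the infimum of a nonempty set is its least element and \<open>Inf {} = \<infinity>\<close>.
  The category of a point is 1 (unnormalised convention).\<close>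

definition ls_cat :: "'a topology \<Rightarrow> enat" where
  "ls_cat X = Inf (enat ` {k. 1 \<le> k \<and> (\<exists>U. categorical_cover X k U)})"

end

theory Submission
  imports Defs
begin

text \<open>Let \<open>r\<close> be the retraction. If \<open>U\<close> contracts in
  \<open>X\<close> to a point \<open>c\<close>, follow the contraction by \<open>r\<close> and start
  it only at points of \<open>A \<inter> U\<close>: the result stays in \<open>A\<close>, begins at
  the inclusion because \<open>r\<close> fixes \<open>A\<close>, and ends at \<open>r c\<close>. So
  the traces on \<open>A\<close> of a categorical cover of \<open>X\<close> form a categorical cover
  of \<open>A\<close> with the same number of sets.\<close>

lemma null_homotopic_restrict_retract:
  assumes r: "continuous_map X (subtopology X A) r" and fix_r: "\<forall>x\<in>A. r x = x"
    and U: "null_homotopic (subtopology X U) X (\<lambda>x. x)"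
  shows "null_homotopic (subtopology (subtopology X A) (A \<inter> U)) (subtopology X A) (\<lambda>x. x)"
proof -
  let ?V = "subtopology (subtopology X A) (A \<inter> U)"
  from U obtain c where c: "homotopic_with (\<lambda>_. True) (subtopology X U) X (\<lambda>x. x) (\<lambda>_. c)"
    by (auto simp: null_homotopic_def)
  have inc: "continuous_map ?V (subtopology X U) (\<lambda>x. x)"
    by (auto simp: subtopology_subtopology continuous_map_in_subtopology
        intro: continuous_map_from_subtopology)
  \<comment> \<open>The given homotopy may leave \<open>A\<close>, even from points of
    \<open>A\<close>; composing with \<open>r\<close> pushes it back.\<close>
  have "homotopic_with (\<lambda>_. True) (subtopology X U) (subtopology X A) (r \<circ> (\<lambda>x. x)) (r \<circ> (\<lambda>_. c))"
    by (rule homotopic_with_compose_continuous_map_left[OF c r]) simp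
  then have "homotopic_with (\<lambda>_. True) ?V (subtopology X A)
      ((r \<circ> (\<lambda>x. x)) \<circ> (\<lambda>x. x)) ((r \<circ> (\<lambda>_. c)) \<circ> (\<lambda>x. x))"
    by (rule homotopic_with_compose_continuous_map_right[OF _ inc]) simp
  \<comment> \<open>\<open>r\<close> agrees with the identity only on \<open>A\<close>, which
    suffices since the points of \<open>?V\<close> lie in \<open>A\<close>.\<close>
  then have "homotopic_with (\<lambda>_. True) ?V (subtopology X A) (\<lambda>x. x) (\<lambda>_. r c)"
    by (rule homotopic_with_eq) (use fix_r in auto)
  moreover have "continuous_map ?V (subtopology X A) (\<lambda>x. x)"
    by (simp add: continuous_map_from_subtopology)
  ultimately show ?thesis
    by (auto simp: null_homotopic_def)
qed

text \<open>Intersecting with \<open>A\<close> keeps the index set, hence \<open>k\<close>. Some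
  traces may be empty, which is harmless because the empty map counts as null-homotopic.\<close>

lemma categorical_cover_retract:
  assumes "A retract_of_space X" and U: "categorical_cover X k U"
  shows "categorical_cover (subtopology X A) k (\<lambda>j. A \<inter> U j)"
proof -
  obtain r where A: "A \<subseteq> topspace X" and r: "continuous_map X (subtopology X A) r" "\<forall>x\<in>A. r x = x"
    using assms(1) by (auto simp: retract_of_space_def)
  have "(\<Union>j\<in>{1..k}. A \<inter> U j) = topspace (subtopology X A)"
    using U A by (auto simp: categorical_cover_def)
  moreover have "openin (subtopology X A) (A \<inter> U j)"
    "null_homotopic (subtopology (subtopology X A) (A \<inter> U j)) (subtopology X A) (\<lambda>x. x)"
    if "j \<in> {1..k}" for j
  proof -
    have "openin X (U j)" "null_homotopic (subtopology X (U j)) X (\<lambda>x. x)"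
      using U that unfolding categorical_cover_def by auto
    then show "openin (subtopology X A) (A \<inter> U j)"
      "null_homotopic (subtopology (subtopology X A) (A \<inter> U j)) (subtopology X A) (\<lambda>x. x)"
      by (simp_all add: openin_subtopology_Int2 null_homotopic_restrict_retract[OF r])
  qed
  ultimately show ?thesis
    by (simp add: categorical_cover_def)
qed

theorem mainTheorem18:
  fixes X :: "'a topology" and A :: "'a set"
  assumes "A \<subseteq> topspace X"
    and "A retract_of_space X"
  shows "ls_cat (subtopology X A) \<le> ls_cat X"
proof -
  \<comment> \<open>A larger set has a smaller infimum; if \<open>X\<close> has no finite
    categorical cover, the left set is empty and its infimum is \<open>\<infinity>\<close>.\<close>
  have "{k. 1 \<le> k \<and> (\<exists>U. categorical_cover X k U)}
      \<subseteq> {k. 1 \<le> k \<and> (\<exists>V. categorical_cover (subtopology X A) k V)}"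
    by (auto dest: categorical_cover_retract[OF assms(2)])
  then show ?thesis
    unfolding ls_cat_def by (intro Inf_superset_mono image_mono)
qed

end
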